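(* If $\mathbf{W}$ is a convex body of constant width in $\mathbf{E}^4$, then $X(\mathbf{W})\le 6$. Moreover, if $d\in\{5,6\}$ and $\mathbf{W}$ is a convex body of constant width in $\mathbf{E}^d$, then $X(\mathbf{W})\le 2^{d-1}$.
   Context: $\mathbf{E}^d$ is $d$-dimensional Euclidean space. A convex body in $\mathbf{E}^d$ is a compact convex set with non-empty interior. It has constant width if the distance between its two parallel supporting hyperplanes is the same in every direction. X-ray number: for a convex body $\mathbf{K}\subset\mathbf{E}^d$ and a line $L$ through the origin, a point $p\in\mathbf{K}$ is X-rayed along $L$ if the line parallel to $L$ passing through $p$ intersects the interior of $\mathbf{K}$. The X-ray number $X(\mathbf{K})$ is the smallest number of lines through the origin such that every point of $\mathbf{K}$ is X-rayed along at least one of these lines. *)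

theory Defs
  imports "HOL-Analysis.Analysis" "HOL-Library.Extended_Nat"
begin

definition convex_body :: "'a::euclidean_space set \<Rightarrow> bool" where
  "convex_body K \<longleftrightarrow> compact K \<and> convex K \<and> interior K \<noteq> {}"

definition supporting_hyperplane :: "'a::euclidean_space set \<Rightarrow> 'a set \<Rightarrow> bool" where
  "supporting_hyperplane K H \<longleftrightarrow>
     (\<exists>a b. a \<noteq> 0 \<and> H = {x. a \<bullet> x = b} \<and> K \<subseteq> {x. a \<bullet> x \<le> b} \<and> H \<inter> K \<noteq> {})"

text \<open>A convex body has exactly two supporting hyperplanes orthogonal to any given direction, so the
  pairs of distinct parallel supporting hyperplanes correspond to the directions (up to sign).
  Without \<open>H \<noteq> H'\<close> every hyperplane would be paired with itself, at distance 0.\<close>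

definition constant_width :: "'a::euclidean_space set \<Rightarrow> bool" where
  "constant_width K \<longleftrightarrow>
     (\<exists>w. \<forall>H H'. supporting_hyperplane K H \<and> supporting_hyperplane K H' \<and>
        affine_parallel H H' \<and> H \<noteq> H' \<longrightarrow> setdist H H' = w)"

definition line_through_origin :: "'a::euclidean_space set \<Rightarrow> bool" where
  "line_through_origin L \<longleftrightarrow> subspace L \<and> dim L = 1"

definition xrayed_along :: "'a::euclidean_space set \<Rightarrow> 'a \<Rightarrow> 'a set \<Rightarrow> bool" where
  "xrayed_along K p L \<longleftrightarrow> (\<lambda>x. p + x) ` L \<inter> interior K \<noteq> {}"

text \<open>With values in \<^typ>\<open>enat\<close>, the infimum is attained whenever a finite X-raying family exists,
  and would be \<open>\<infinity>\<close> otherwise.\<close>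

definition xray_number :: "'a::euclidean_space set \<Rightarrow> enat" where
  "xray_number K =
     (INF \<L>\<in>{\<L>. finite \<L> \<and> (\<forall>L\<in>\<L>. line_through_origin L) \<and>
               (\<forall>p\<in>K. \<exists>L\<in>\<L>. xrayed_along K p L)}. enat (card \<L>))"

end

(* If the line through p along v misses the interior of W, a separating hyperplane yields a unit
   normal of W at p orthogonal to v. Constant width forces any two unit normals at p to have inner
   product at least 1/2, and then a Jung-type argument puts all of them in a spherical cap: there is
   a unit vector c with n.c >= sqrt ((d+1)/(2d)) for all unit normals n at p. Hence (v.c)^2 <=
   |v|^2 (d-1)/(2d) for every v whose line does not X-ray p, so it suffices to find few lines such
   that each unit vector c violates this inequality for one of them. The space is split into
   orthogonal summands: 4 = 2 + 2 with 3 + 3 lines, 5 = 2 + 3 with 5 + 11 lines and 6 = 3 + 3 with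
   16 + 16 lines. The 4-dimensional configuration only attains equality; in the extremal case the
   normals are determined, and two of them have inner product 2/5 < 1/2. *)

theory Submission
  imports Defs
begin

section \<open>Constant width in terms of unit normals\<close>

lemma setdist_hyperplanes:
  fixes u :: "'a::euclidean_space"
  assumes "norm u = 1"
  shows "setdist {x. u \<bullet> x = a} {x. u \<bullet> x = b} = \<bar>a - b\<bar>"
proof (rule antisym)
  have uu: "u \<bullet> u = 1" using assms by (simp add: norm_eq_1)
  have "setdist {x. u \<bullet> x = a} {x. u \<bullet> x = b} \<le> dist (a *\<^sub>R u) (b *\<^sub>R u)"
    by (rule setdist_le_dist) (auto simp: uu)
  also have "\<dots> = \<bar>a - b\<bar>"
    by (simp add: dist_norm assms flip: scaleR_diff_left)
  finally show "setdist {x. u \<bullet> x = a} {x. u \<bullet> x = b} \<le> \<bar>a - b\<bar>" .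
  have ne: "{x. u \<bullet> x = c} \<noteq> {}" for c
    using uu by (auto intro!: exI[of _ "c *\<^sub>R u"])
  show "\<bar>a - b\<bar> \<le> setdist {x. u \<bullet> x = a} {x. u \<bullet> x = b}"
  proof (rule le_setdistI)
    fix x y assume "x \<in> {x. u \<bullet> x = a}" "y \<in> {x. u \<bullet> x = b}"
    then have "a - b = u \<bullet> (x - y)" by (simp add: inner_diff_right)
    then show "\<bar>a - b\<bar> \<le> dist x y"
      using Cauchy_Schwarz_ineq2[of u "x - y"] assms by (simp add: dist_norm)
  qed (use ne in auto)
qed

text \<open>A maximiser and a minimiser of \<open>u \<bullet> x\<close> on \<open>W\<close> lie on
  two parallel supporting hyperplanes, whose distance is the difference of the two values. The
  diameter bound follows by taking \<open>u\<close> along \<open>x - y\<close>.\<close>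

lemma constant_width_obtain:
  fixes W :: "'a::euclidean_space set"
  assumes "convex_body W" "constant_width W"
  obtains w where "w > 0"
    "\<And>x y. x \<in> W \<Longrightarrow> y \<in> W \<Longrightarrow> dist x y \<le> w"
    "\<And>u p. norm u = 1 \<Longrightarrow> p \<in> W \<Longrightarrow> (\<forall>x\<in>W. u \<bullet> x \<le> u \<bullet> p) \<Longrightarrow> \<exists>q\<in>W. u \<bullet> p - u \<bullet> q = w"
proof -
  obtain w where w: "\<And>H H'. supporting_hyperplane W H \<Longrightarrow> supporting_hyperplane W H' \<Longrightarrow>
      affine_parallel H H' \<Longrightarrow> H \<noteq> H' \<Longrightarrow> setdist H H' = w"
    using assms(2) unfolding constant_width_def by metis
  have cpt: "compact W" and int: "interior W \<noteq> {}"
    using assms(1) unfolding convex_body_def by auto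
  have width: "\<exists>p\<in>W. \<exists>q\<in>W. (\<forall>x\<in>W. u \<bullet> x \<le> u \<bullet> p) \<and> (\<forall>x\<in>W. u \<bullet> q \<le> u \<bullet> x) \<and> u \<bullet> p - u \<bullet> q = w"
    if u: "norm u = 1" for u :: 'a
  proof -
    have ne: "W \<noteq> {}" using int interior_subset by blast
    have cont: "continuous_on W (\<lambda>x. u \<bullet> x)" by (intro continuous_intros)
    obtain p where p: "p \<in> W" "\<And>x. x \<in> W \<Longrightarrow> u \<bullet> x \<le> u \<bullet> p"
      using continuous_attains_sup[OF cpt ne cont] by blast
    obtain q where q: "q \<in> W" "\<And>x. x \<in> W \<Longrightarrow> u \<bullet> q \<le> u \<bullet> x"
      using continuous_attains_inf[OF cpt ne cont] by blast
    have uu: "u \<bullet> u = 1" using u by (simp add: norm_eq_1)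
    have u0: "u \<noteq> 0" using u by auto
    let ?H = "{x. u \<bullet> x = u \<bullet> p}" and ?H' = "{x. u \<bullet> x = u \<bullet> q}"
    \<comment> \<open>Nonempty interior makes the two hyperplanes distinct; the definition says
      nothing about a hyperplane paired with itself.\<close>
    have lt: "u \<bullet> q < u \<bullet> p"
    proof -
      obtain z e where z: "e > 0" "cball z e \<subseteq> W" using int mem_interior_cball by blast
      have 1: "z + e *\<^sub>R u \<in> W" using z u by (intro subsetD[OF z(2)]) (simp add: dist_norm)
      have 2: "z \<in> W" using z by auto
      show ?thesis using p(2)[OF 1] q(2)[OF 2] z(1) by (simp add: inner_add_right uu)
    qed
    have s1: "supporting_hyperplane W ?H"
      unfolding supporting_hyperplane_def
      by (rule exI[of _ u], rule exI[of _ "u \<bullet> p"]) (use u0 p in auto)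
    have s2: "supporting_hyperplane W ?H'"
      unfolding supporting_hyperplane_def
      by (rule exI[of _ "-u"], rule exI[of _ "- (u \<bullet> q)"]) (use u0 q in auto)
    have par: "affine_parallel ?H ?H'"
      unfolding affine_parallel_def
    proof (rule exI[of _ "q - p"], intro equalityI subsetI)
      fix x assume "x \<in> ?H'"
      then show "x \<in> (\<lambda>y. (q - p) + y) ` ?H"
        by (intro image_eqI[of _ _ "x - (q - p)"]) (auto simp: inner_diff_right)
    qed (auto simp: inner_diff_right inner_add_right)
    have "p \<in> ?H" "p \<notin> ?H'" using lt by auto
    then have "?H \<noteq> ?H'" by blast
    then have "w = \<bar>u \<bullet> p - u \<bullet> q\<bar>"
      using w[OF s1 s2 par] setdist_hyperplanes[OF u] by simp
    then show ?thesis using lt p q by (intro bexI[of _ p] bexI[of _ q]) auto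
  qed
  show ?thesis
  proof
    show dist: "dist x y \<le> w" if "x \<in> W" "y \<in> W" for x y
    proof (cases "x = y")
      case True
      \<comment> \<open>Only \<open>0 \<le> w\<close> is at stake here, and any direction provides
        it.\<close>
      obtain u :: 'a where "norm u = 1" using vector_choose_size[of 1] by auto
      from width[OF this] obtain p q where "p \<in> W" "q \<in> W" "\<forall>x\<in>W. u \<bullet> x \<le> u \<bullet> p" "u \<bullet> p - u \<bullet> q = w"
        by blast
      then show ?thesis using True by force
    next
      case False
      define u where "u = (x - y) /\<^sub>R norm (x - y)"
      have u: "norm u = 1" using False by (simp add: u_def)
      have "u \<bullet> (x - y) = norm (x - y)"
        using False by (simp add: u_def power2_norm_eq_inner[symmetric] power2_eq_square)
      moreover from width[OF u] obtain p q where pq: "\<forall>x\<in>W. u \<bullet> x \<le> u \<bullet> p" "\<forall>x\<in>W. u \<bullet> q \<le> u \<bullet> x"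
          "u \<bullet> p - u \<bullet> q = w"
        by blast
      have "u \<bullet> x \<le> u \<bullet> p" "u \<bullet> q \<le> u \<bullet> y" using pq that by auto
      ultimately show ?thesis using pq(3) by (simp add: inner_diff_right dist_norm)
    qed
    obtain z e where z: "e > 0" "cball z e \<subseteq> W" using int mem_interior_cball by blast
    obtain b :: 'a where b: "norm b = 1" using vector_choose_size[of 1] by auto
    have "z \<in> W" "z + e *\<^sub>R b \<in> W" using z b by (auto intro!: subsetD[OF z(2)] simp: dist_norm)
    from dist[OF this] show "w > 0" using z b by (simp add: dist_norm)
    show "\<exists>q\<in>W. u \<bullet> p - u \<bullet> q = w"
      if u: "norm u = 1" and p: "p \<in> W" and sup: "\<forall>x\<in>W. u \<bullet> x \<le> u \<bullet> p" for u p
    proof -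
      from width[OF u] obtain p' q where pq: "p' \<in> W" "q \<in> W" "\<forall>x\<in>W. u \<bullet> x \<le> u \<bullet> p'"
          "u \<bullet> p' - u \<bullet> q = w"
        by blast
      then have "u \<bullet> p' = u \<bullet> p" using p sup by (intro antisym) auto
      then show ?thesis using pq by auto
    qed
  qed
qed

text \<open>If \<open>n\<close> is a unit normal at \<open>p\<close>, then \<open>p - w n\<close> is again a point of \<open>W\<close>; since the diameter
  of \<open>W\<close> is \<open>w\<close>, two such normals are at distance at most 1.\<close>

lemma constant_width_normals:
  fixes W :: "'a::euclidean_space set"
  assumes W: "convex_body W" "constant_width W"
    and p: "p \<in> W"
    and m: "norm m = 1" "\<forall>x\<in>W. m \<bullet> x \<le> m \<bullet> p"
    and n: "norm n = 1" "\<forall>x\<in>W. n \<bullet> x \<le> n \<bullet> p"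
  shows "m \<bullet> n \<ge> 1/2"
proof -
  obtain w where w: "w > 0" "\<And>x y. x \<in> W \<Longrightarrow> y \<in> W \<Longrightarrow> dist x y \<le> w"
    "\<And>u p. norm u = 1 \<Longrightarrow> p \<in> W \<Longrightarrow> (\<forall>x\<in>W. u \<bullet> x \<le> u \<bullet> p) \<Longrightarrow> \<exists>q\<in>W. u \<bullet> p - u \<bullet> q = w"
    using constant_width_obtain[OF W] by blast
  have opp: "p - w *\<^sub>R u \<in> W" if u: "norm u = 1" "\<forall>x\<in>W. u \<bullet> x \<le> u \<bullet> p" for u
  proof -
    obtain q where q: "q \<in> W" "u \<bullet> p - u \<bullet> q = w" using w(3)[OF u(1) p u(2)] by blast
    \<comment> \<open>The vector \<open>p - q\<close> has length at most \<open>w\<close> and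
      component \<open>w\<close> along \<open>u\<close>, so it can only be \<open>w\<close> times
      \<open>u\<close>.\<close>
    have "(norm (p - q - w *\<^sub>R u))\<^sup>2 = (norm (p - q))\<^sup>2 - 2 * w * (u \<bullet> (p - q)) + w\<^sup>2 * (u \<bullet> u)"
      unfolding power2_norm_eq_inner
      by (simp add: inner_diff_left inner_diff_right inner_commute power2_eq_square algebra_simps)
    also have "\<dots> = (norm (p - q))\<^sup>2 - w\<^sup>2"
      using q u(1) by (simp add: inner_diff_right norm_eq_1 power2_eq_square)
    also have "\<dots> \<le> 0"
      using w(2)[OF p q(1)] by (simp add: dist_norm power_mono)
    finally have "p - q - w *\<^sub>R u = 0" by simp
    then have "p - w *\<^sub>R u = q" by (simp add: algebra_simps)
    then show ?thesis using q by simp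
  qed
  have "dist (p - w *\<^sub>R m) (p - w *\<^sub>R n) \<le> w" using opp m n w(2) by blast
  moreover have "dist (p - w *\<^sub>R m) (p - w *\<^sub>R n) = w * norm (n - m)"
    using w(1) by (simp add: dist_norm flip: scaleR_diff_right)
  ultimately have "norm (n - m) \<le> 1" using w(1) by simp
  then have "(norm (n - m))\<^sup>2 \<le> 1" by (simp add: power_le_one)
  then show ?thesis using m n unfolding power2_norm_eq_inner
    by (simp add: inner_diff_left inner_diff_right inner_commute norm_eq_1)
qed

section \<open>X-rays and normals orthogonal to a line\<close>

lemma not_xrayed_obtain_normal:
  fixes W :: "'a::euclidean_space set"
  assumes W: "convex_body W" and p: "p \<in> W" and nx: "\<not> xrayed_along W p (span {v})"
  obtains n where "norm n = 1" "n \<bullet> v = 0" "\<forall>x\<in>W. n \<bullet> x \<le> n \<bullet> p"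
proof -
  let ?L = "(\<lambda>x. p + x) ` span {v}"
  have cW: "convex W" "interior W \<noteq> {}" "closed W"
    using W unfolding convex_body_def by (auto simp: compact_imp_closed)
  have "interior W \<inter> ?L = {}" using nx unfolding xrayed_along_def by blast
  moreover have "convex ?L" by (simp add: convex_translation subspace_imp_convex)
  moreover have pL: "p + t *\<^sub>R v \<in> ?L" for t
    by (simp add: span_scale span_base)
  ultimately obtain a b where ab: "a \<noteq> 0" "\<forall>x\<in>interior W. a \<bullet> x \<le> b" "\<forall>x\<in>?L. a \<bullet> x \<ge> b"
    using separating_hyperplane_sets[OF convex_interior[OF cW(1)] _ cW(2), of ?L] by blast
  have le: "b \<le> a \<bullet> p + t * (a \<bullet> v)" for t
    using ab(3) pL[of t] by (fastforce simp: inner_add_right)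
  \<comment> \<open>A linear function bounded below on a whole line is constant on it: the
    \<open>t\<close> chosen below would turn the bound into \<open>b \<le> b - 1\<close>.\<close>
  have av: "a \<bullet> v = 0"
  proof (rule ccontr)
    assume "a \<bullet> v \<noteq> 0"
    then show False using le[of "(b - 1 - a \<bullet> p) / (a \<bullet> v)"] by simp
  qed
  \<comment> \<open>The separation concerns only the interior; \<open>W\<close> is the closure of
    its interior, and the halfspace is closed.\<close>
  have "W \<subseteq> {x. a \<bullet> x \<le> b}"
  proof -
    have "closure (interior W) \<subseteq> {x. a \<bullet> x \<le> b}"
      using ab(2) by (intro closure_minimal closed_halfspace_le) auto
    then show ?thesis
      using convex_closure_interior[OF cW(1,2)] cW(3) by simp
  qed
  then have "\<forall>x\<in>W. a \<bullet> x \<le> a \<bullet> p" using le[of 0] by force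
  then show ?thesis
    using ab(1) av
    by (intro that[of "a /\<^sub>R norm a"]) (auto simp: divide_simps)
qed

text \<open>A point that no line X-rays would yield, for each \<open>v\<close>, a unit normal
  orthogonal to \<open>v\<close>. All these normals belong to the same point, so
  \<open>constant_width_normals\<close> applies to each pair. What remains is a question about unit
  vectors in which \<open>W\<close> no longer occurs.\<close>

lemma xray_number_le_card:
  fixes W F :: "'a::euclidean_space set"
  assumes W: "convex_body W" "constant_width W"
    and F: "finite F" "0 \<notin> F"
    and no: "\<And>n. (\<And>v. v \<in> F \<Longrightarrow> norm (n v) = 1) \<Longrightarrow> (\<And>v. v \<in> F \<Longrightarrow> n v \<bullet> v = 0) \<Longrightarrow>
      (\<And>u v. u \<in> F \<Longrightarrow> v \<in> F \<Longrightarrow> n u \<bullet> n v \<ge> 1/2) \<Longrightarrow> False"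
  shows "xray_number W \<le> enat (card F)"
proof -
  let ?L = "(\<lambda>v. span {v}) ` F"
  have "\<exists>L\<in>?L. xrayed_along W p L" if p: "p \<in> W" for p
  proof (rule ccontr)
    assume "\<not> (\<exists>L\<in>?L. xrayed_along W p L)"
    then have "\<forall>v\<in>F. \<exists>n. norm n = 1 \<and> n \<bullet> v = 0 \<and> (\<forall>x\<in>W. n \<bullet> x \<le> n \<bullet> p)"
      using not_xrayed_obtain_normal[OF W(1) p] by (metis image_eqI)
    then obtain n where "\<forall>v\<in>F. norm (n v) = 1 \<and> n v \<bullet> v = 0 \<and> (\<forall>x\<in>W. n v \<bullet> x \<le> n v \<bullet> p)"
      by metis
    then show False
      using constant_width_normals[OF W p] by (intro no[of n]) blast+
  qed
  moreover have "line_through_origin L" if "L \<in> ?L" for L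
    using that F(2) unfolding line_through_origin_def by (auto simp: dim_span)
  ultimately have "?L \<in> {\<L>. finite \<L> \<and> (\<forall>L\<in>\<L>. line_through_origin L) \<and>
               (\<forall>p\<in>W. \<exists>L\<in>\<L>. xrayed_along W p L)}"
    using F(1) by blast
  then have "xray_number W \<le> enat (card ?L)"
    unfolding xray_number_def by (rule INF_lower)
  also have "\<dots> \<le> enat (card F)" using F(1) by (simp add: card_image_le)
  finally show ?thesis .
qed

section \<open>A Jung-type theorem for unit vectors\<close>

lemma inner_self_convex_combination_ge:
  fixes S :: "'a::euclidean_space set"
  assumes S: "finite S" "\<And>m. m \<in> S \<Longrightarrow> norm m = 1"
      "\<And>m n. m \<in> S \<Longrightarrow> n \<in> S \<Longrightarrow> m \<bullet> n \<ge> 1/2"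
    and a: "a \<in> convex hull S"
  shows "a \<bullet> a \<ge> 1/2 + 1 / (2 * card S)"
proof -
  obtain u where u: "\<And>m. m \<in> S \<Longrightarrow> 0 \<le> u m" "sum u S = 1" "(\<Sum>m\<in>S. u m *\<^sub>R m) = a"
    using a unfolding convex_hull_finite[OF S(1)] by auto
  \<comment> \<open>The Gram matrix has diagonal 1 and other entries at least 1/2, so the square is
    at least half of \<open>(sum u S)\<^sup>2\<close> plus half of the sum of the squared weights.
    Cauchy-Schwarz bounds the latter sum below by \<open>1 / card S\<close>.\<close>
  have "a \<bullet> a = (\<Sum>m\<in>S. \<Sum>n\<in>S. u m * u n * (m \<bullet> n))"
    unfolding u(3)[symmetric] inner_sum_left inner_sum_right
    by (simp add: sum_distrib_left inner_commute mult_ac)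
  also have "\<dots> \<ge> (\<Sum>m\<in>S. \<Sum>n\<in>S. u m * u n * (1/2 + (if m = n then 1/2 else 0)))"
    using S u(1) by (intro sum_mono mult_left_mono) (auto simp: norm_eq_1)
  also have "(\<Sum>m\<in>S. \<Sum>n\<in>S. u m * u n * (1/2 + (if m = n then 1/2 else 0)))
      = (\<Sum>m\<in>S. \<Sum>n\<in>S. u m * u n) / 2 + (\<Sum>m\<in>S. (u m)\<^sup>2) / 2"
    by (simp add: distrib_left sum.distrib if_distrib[where f = "\<lambda>x. _ * x"] sum_divide_distrib
        S(1) power2_eq_square cong: if_cong)
  also have "(\<Sum>m\<in>S. \<Sum>n\<in>S. u m * u n) = 1"
    using u(2) by (simp flip: sum_product)
  finally have 1: "1/2 + (\<Sum>m\<in>S. (u m)\<^sup>2) / 2 \<le> a \<bullet> a" .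
  have ne: "card S > 0" using u(2) S(1) by (auto simp: card_gt_0_iff)
  have "(sum u S)\<^sup>2 \<le> (\<Sum>m\<in>S. (u m)\<^sup>2) * card S"
    by (rule sum_squared_le_sum_of_squares)
  then have "1 / card S \<le> (\<Sum>m\<in>S. (u m)\<^sup>2)" using u(2) ne by (simp add: field_simps)
  then show ?thesis using 1 by (simp add: field_simps)
qed

text \<open>The centre \<open>c\<close> is the normalised point \<open>a\<close> of the convex hull
  nearest to the origin. By Caratheodory's theorem \<open>a\<close> is a convex combination of at
  most \<open>DIM('a)\<close> of the vectors, and the previous bound then makes
  \<open>norm a\<close> large.\<close>

lemma spherical_jung:
  fixes M :: "'a::euclidean_space set"
  assumes M: "finite M" "M \<noteq> {}" "\<And>m. m \<in> M \<Longrightarrow> norm m = 1"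
      "\<And>m n. m \<in> M \<Longrightarrow> n \<in> M \<Longrightarrow> m \<bullet> n \<ge> 1/2"
  obtains c where "norm c = 1"
    "\<And>m. m \<in> M \<Longrightarrow> m \<bullet> c \<ge> sqrt ((real DIM('a) + 1) / (2 * real DIM('a)))"
proof -
  let ?C = "convex hull M"
  have cl: "closed ?C" using M(1) by (simp add: compact_imp_closed finite_imp_compact_convex_hull)
  have ne: "?C \<noteq> {}" using M(2) by simp
  obtain a where a: "a \<in> ?C" "\<And>z. z \<in> ?C \<Longrightarrow> dist 0 a \<le> dist 0 z"
    using distance_attains_inf[OF cl ne] by blast
  \<comment> \<open>Since \<open>a\<close> is nearest to 0, the hyperplane through \<open>a\<close>
    orthogonal to \<open>a\<close> has all of \<open>M\<close> on its far side.\<close>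
  have sup: "a \<bullet> a \<le> a \<bullet> m" if "m \<in> M" for m
    using any_closest_point_dot[OF convex_convex_hull cl a(1), of m 0] a(2) that
    by (auto simp: hull_inc inner_diff_right)
  have "a \<bullet> a \<ge> 1/2 + 1 / (2 * card M)"
    by (rule inner_self_convex_combination_ge) (use M a in auto)
  moreover have "1 / real (2 * card M) \<ge> 0" by simp
  ultimately have "a \<bullet> a > 0" by linarith
  then have a0: "a \<noteq> 0" by auto
  define T where "T = {m \<in> M. a \<bullet> m = a \<bullet> a}"
  \<comment> \<open>The nonnegative numbers \<open>a \<bullet> m - a \<bullet> a\<close> have
    weighted mean 0, so every weight outside \<open>T\<close> vanishes.\<close>
  have aT: "a \<in> convex hull T"
  proof -
    obtain u where u: "\<And>m. m \<in> M \<Longrightarrow> 0 \<le> u m" "sum u M = 1" "(\<Sum>m\<in>M. u m *\<^sub>R m) = a"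
      using a(1) unfolding convex_hull_finite[OF M(1)] by auto
    have "(\<Sum>m\<in>M. u m * (a \<bullet> m - a \<bullet> a)) = a \<bullet> (\<Sum>m\<in>M. u m *\<^sub>R m) - sum u M * (a \<bullet> a)"
      by (simp add: inner_sum_right right_diff_distrib sum_subtractf sum_distrib_right)
    also have "\<dots> = 0" using u by simp
    finally have "\<forall>m\<in>M. u m * (a \<bullet> m - a \<bullet> a) = 0"
      using sum_nonneg_eq_0_iff[OF M(1), of "\<lambda>m. u m * (a \<bullet> m - a \<bullet> a)"] u(1) sup by simp
    then have z: "\<forall>m\<in>M - T. u m = 0" unfolding T_def by auto
    have "T \<subseteq> M" "finite T" using M(1) by (auto simp: T_def)
    then have "sum u T = 1" "(\<Sum>m\<in>T. u m *\<^sub>R m) = a"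
      using u(2,3) sum.mono_neutral_left[OF M(1) \<open>T \<subseteq> M\<close>] z by (metis (no_types, lifting) scaleR_zero_left)+
    then show ?thesis
      unfolding convex_hull_finite[OF \<open>finite T\<close>] using u(1) \<open>T \<subseteq> M\<close> by blast
  qed
  \<comment> \<open>Because \<open>T\<close> lies in a hyperplane, Caratheodory needs
    \<open>DIM('a)\<close> points instead of \<open>DIM('a) + 1\<close>; this gives the constant its
    exact form.\<close>
  have "aff_dim T \<le> aff_dim {x. a \<bullet> x = a \<bullet> a}" by (intro aff_dim_subset) (auto simp: T_def)
  then have dimT: "aff_dim T + 1 \<le> int DIM('a)" using a0 by simp
  obtain S where S: "finite S" "S \<subseteq> T" "int (card S) \<le> aff_dim T + 1" "a \<in> convex hull S"
    using aT unfolding caratheodory_aff_dim[of T] by auto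
  have "a \<bullet> a \<ge> 1/2 + 1 / (2 * card S)"
    using S(2) by (intro inner_self_convex_combination_ge S M) (auto simp: T_def)
  moreover have "1 / (2 * real DIM('a)) \<le> 1 / real (2 * card S)"
  proof (rule divide_left_mono)
    show "real (2 * card S) \<le> 2 * real DIM('a)" using S(3) dimT by linarith
    have "card S > 0" using S(1,4) by (auto simp: card_gt_0_iff)
    then show "0 < 2 * real DIM('a) * real (2 * card S)" by simp
  qed simp
  ultimately have "a \<bullet> a \<ge> 1/2 + 1 / (2 * real DIM('a))" by linarith
  then have na: "norm a \<ge> sqrt ((real DIM('a) + 1) / (2 * real DIM('a)))"
    unfolding norm_eq_sqrt_inner by (intro real_sqrt_le_mono) (simp add: field_simps)
  show ?thesis
  proof
    show "norm (a /\<^sub>R norm a) = 1" using a0 by simp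
    fix m assume "m \<in> M"
    then have "norm a * norm a \<le> m \<bullet> a"
      using sup[of m] by (simp add: inner_commute norm_eq_sqrt_inner)
    then have "norm a \<le> m \<bullet> (a /\<^sub>R norm a)" using a0 by (simp add: field_simps)
    with na show "m \<bullet> (a /\<^sub>R norm a) \<ge> sqrt ((real DIM('a) + 1) / (2 * real DIM('a)))" by simp
  qed
qed

section \<open>Reduction to covering the unit vectors\<close>

lemma inner_le_of_orthogonal:
  fixes c :: "'a::real_inner"
  assumes "norm m = 1" "norm c = 1" "m \<bullet> v = 0" "0 \<le> k" "k \<le> m \<bullet> c"
  shows "(v \<bullet> c)\<^sup>2 \<le> (v \<bullet> v) * (1 - k\<^sup>2)"
proof -
  let ?d = "c - (m \<bullet> c) *\<^sub>R m"
  \<comment> \<open>As \<open>v\<close> is orthogonal to \<open>m\<close>, only the component of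
    \<open>c\<close> orthogonal to \<open>m\<close> matters; its squared length is
    \<open>1 - (m \<bullet> c)\<^sup>2\<close>.\<close>
  have "v \<bullet> c = v \<bullet> ?d" using assms(3) by (simp add: inner_diff_right inner_commute)
  then have "(v \<bullet> c)\<^sup>2 \<le> (v \<bullet> v) * (?d \<bullet> ?d)" by (simp only: Cauchy_Schwarz_ineq)
  also have "?d \<bullet> ?d = 1 - (m \<bullet> c)\<^sup>2"
    using assms(1,2)
    by (simp add: inner_diff_left inner_diff_right inner_commute norm_eq_1 power2_eq_square)
  also have "(v \<bullet> v) * (1 - (m \<bullet> c)\<^sup>2) \<le> (v \<bullet> v) * (1 - k\<^sup>2)"
    using assms(4,5) by (intro mult_left_mono) (auto intro: power_mono)
  finally show ?thesis .
qed

text \<open>The equality case of the previous bound: \<open>m\<close> must point along the component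
  of \<open>c\<close> orthogonal to \<open>v\<close>. It serves dimension 4, where the covering
  inequality is not strict.\<close>

lemma eq_of_inner_eq_of_orthogonal:
  fixes c :: "'a::real_inner"
  assumes "norm m = 1" "norm c = 1" "m \<bullet> v = 0" "0 \<le> k" "k \<le> m \<bullet> c" "v \<noteq> 0"
    and "(v \<bullet> c)\<^sup>2 = (v \<bullet> v) * (1 - k\<^sup>2)"
  shows "k *\<^sub>R m = c - ((v \<bullet> c) / (v \<bullet> v)) *\<^sub>R v"
proof -
  let ?t = "(v \<bullet> c) / (v \<bullet> v)"
  have vv: "v \<bullet> v \<noteq> 0" using assms(6) by simp
  have t: "?t * (v \<bullet> v) = v \<bullet> c" "?t * (v \<bullet> c) = 1 - k\<^sup>2"
    using vv assms(7) by (simp_all add: power2_eq_square field_simps)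
  let ?z = "k *\<^sub>R m - (c - ?t *\<^sub>R v)"
  have "?z \<bullet> ?z = k\<^sup>2 * (m \<bullet> m) + c \<bullet> c + ?t * (?t * (v \<bullet> v)) - 2 * (k * (m \<bullet> c)) - 2 * (?t * (v \<bullet> c))
     + 2 * ?t * k * (m \<bullet> v)"
    by (simp add: inner_diff_left inner_diff_right inner_commute power2_eq_square algebra_simps)
  also have "\<dots> = 2 * k\<^sup>2 - 2 * (k * (m \<bullet> c))"
    unfolding t using assms(1-3) t(2) by (simp add: norm_eq_1)
  also have "\<dots> \<le> 0" using assms(4,5) by (simp add: power2_eq_square mult_left_mono)
  finally have "?z = 0" by (metis inner_gt_zero_iff not_le)
  then show ?thesis by (simp only: eq_iff_diff_eq_0[symmetric])
qed

lemma xray_number_le_cover: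
  fixes W F :: "'a::euclidean_space set"
  assumes W: "convex_body W" "constant_width W"
    and F: "finite F"
    and cover: "\<And>c. norm c = 1 \<Longrightarrow>
      \<exists>v\<in>F. (v \<bullet> v) * ((real DIM('a) - 1) / (2 * real DIM('a))) < (v \<bullet> c)\<^sup>2"
  shows "xray_number W \<le> enat (card F)"
proof -
  \<comment> \<open>The zero vector spans no line and never satisfies the strict inequality, so
    dropping it keeps the cover.\<close>
  let ?F = "F - {0}"
  have "xray_number W \<le> enat (card ?F)"
  proof (rule xray_number_le_card[OF W])
    fix n assume n: "\<And>v. v \<in> ?F \<Longrightarrow> norm (n v) = 1" "\<And>v. v \<in> ?F \<Longrightarrow> n v \<bullet> v = 0"
      "\<And>u v. u \<in> ?F \<Longrightarrow> v \<in> ?F \<Longrightarrow> n u \<bullet> n v \<ge> 1/2"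
    let ?k = "sqrt ((real DIM('a) + 1) / (2 * real DIM('a)))"
    \<comment> \<open>Covering a single unit vector already shows that \<open>?F\<close> is
      nonempty, as \<open>spherical_jung\<close> requires.\<close>
    obtain e :: 'a where e: "norm e = 1" using vector_choose_size[of 1] by auto
    have "?F \<noteq> {}" using cover[OF e] by auto
    then obtain c where c: "norm c = 1" "\<And>m. m \<in> n ` ?F \<Longrightarrow> m \<bullet> c \<ge> ?k"
      using F n by (rule_tac spherical_jung[of "n ` ?F"]) auto
    obtain v where v: "v \<in> F" "(v \<bullet> v) * ((real DIM('a) - 1) / (2 * real DIM('a))) < (v \<bullet> c)\<^sup>2"
      using cover[OF c(1)] by blast
    then have vF: "v \<in> ?F" by auto
    have "(v \<bullet> c)\<^sup>2 \<le> (v \<bullet> v) * (1 - ?k\<^sup>2)"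
      using vF by (intro inner_le_of_orthogonal[of "n v"] n c) auto
    also have "1 - ?k\<^sup>2 = (real DIM('a) - 1) / (2 * real DIM('a))"
      by (simp add: field_simps)
    finally show False using v by simp
  qed (use F in auto)
  also have "\<dots> \<le> enat (card F)" using F by (simp add: card_mono)
  finally show ?thesis .
qed

text \<open>Only the dimension of \<open>'a\<close> is known, so coordinates are lists relative to
  an enumerated basis. Configurations become lists of literals, and inner products become sums that
  simplification can expand.\<close>

definition lincomb :: "'a::real_vector list \<Rightarrow> real list \<Rightarrow> 'a" where
  "lincomb bs ks = (\<Sum>i<length bs. (ks ! i) *\<^sub>R (bs ! i))"

lemma inner_lincomb:
  fixes bs :: "'a::euclidean_space list"
  assumes "distinct bs" "set bs \<subseteq> Basis"
  shows "lincomb bs ks \<bullet> lincomb bs ls = (\<Sum>i<length bs. ks ! i * ls ! i)"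
proof -
  have "bs ! i \<bullet> bs ! j = (if i = j then 1 else 0)" if "i < length bs" "j < length bs" for i j
    using that assms subsetD[OF assms(2) nth_mem] by (simp add: inner_Basis nth_eq_iff_index_eq)
  then show ?thesis
    unfolding lincomb_def inner_sum_left inner_sum_right
    by (auto simp: if_distrib[where f = "\<lambda>x. _ * x"] intro!: sum.cong cong: if_cong)
qed

lemma obtain_basis_list:
  obtains bs :: "'a::euclidean_space list" where "distinct bs" "set bs = Basis"
    "length bs = DIM('a)" "\<And>c. \<exists>xs. length xs = DIM('a) \<and> c = lincomb bs xs"
proof -
  obtain bs :: "'a list" where bs: "distinct bs" "set bs = Basis"
    using finite_distinct_list[OF finite_Basis] by blast
  have len: "length bs = DIM('a)" using bs distinct_card by metis
  have "c = lincomb bs (map (inner c) bs)" for c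
  proof -
    have "c = (\<Sum>b\<in>set bs. (c \<bullet> b) *\<^sub>R b)" using bs by (simp add: euclidean_representation)
    also have "\<dots> = (\<Sum>i<length bs. (c \<bullet> bs ! i) *\<^sub>R (bs ! i))"
      using bs(1) by (intro sum.reindex_bij_betw[symmetric] bij_betw_nth) auto
    finally show ?thesis by (simp add: lincomb_def)
  qed
  then show ?thesis using that bs len by (metis length_map)
qed

lemma xray_number_le_cover_coordinates:
  fixes W :: "'a::euclidean_space set" and Ks :: "real list list"
  assumes W: "convex_body W" "constant_width W" and d: "DIM('a) = d"
    and cover: "\<And>xs. length xs = d \<Longrightarrow> (\<Sum>i<d. (xs ! i)\<^sup>2) = 1 \<Longrightarrow>
      \<exists>ks\<in>set Ks. (\<Sum>i<d. (ks ! i)\<^sup>2) * ((real d - 1) / (2 * real d)) < (\<Sum>i<d. ks ! i * xs ! i)\<^sup>2"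
  shows "xray_number W \<le> enat (length Ks)"
proof -
  obtain bs :: "'a list" where bs: "distinct bs" "set bs = Basis" "length bs = d"
    "\<And>c. \<exists>xs. length xs = d \<and> c = lincomb bs xs"
    using obtain_basis_list d by metis
  note inn = inner_lincomb[OF bs(1) equalityD1[OF bs(2)], unfolded bs(3)]
  have "xray_number W \<le> enat (card (lincomb bs ` set Ks))"
  proof (rule xray_number_le_cover[OF W])
    fix c :: 'a assume c: "norm c = 1"
    obtain xs where xs: "length xs = d" "c = lincomb bs xs" using bs(4) by blast
    have "(\<Sum>i<d. (xs ! i)\<^sup>2) = 1" using c xs(2) inn by (simp add: norm_eq_1 power2_eq_square)
    from cover[OF xs(1) this]
    show "\<exists>v\<in>lincomb bs ` set Ks. (v \<bullet> v) * ((real DIM('a) - 1) / (2 * real DIM('a))) < (v \<bullet> c)\<^sup>2"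
      unfolding xs(2) d by (simp add: inn power2_eq_square)
  qed simp
  also have "\<dots> \<le> enat (length Ks)"
    using card_image_le[of "set Ks" "lincomb bs"] card_length[of Ks] by simp
  finally show ?thesis .
qed

section \<open>Covering the plane and 3-space by cones around few lines\<close>

lemma nonneg_if_multiple_nonneg:
  fixes x y n :: real
  assumes "n * x = y" "0 \<le> y" "0 < n"
  shows "0 \<le> x"
  using assms by (auto simp: zero_le_mult_iff)

text \<open>The configurations are symmetric under changes of sign; this transfers their bounds to
  absolute values, so that only nonnegative coordinates need to be examined.\<close>

lemma power2_abs_add_le:
  fixes x y :: real
  assumes "(x + y)\<^sup>2 \<le> t" "(x - y)\<^sup>2 \<le> t"
  shows "(\<bar>x\<bar> + \<bar>y\<bar>)\<^sup>2 \<le> t"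
proof -
  have "\<bar>x\<bar> + \<bar>y\<bar> = \<bar>x + y\<bar> \<or> \<bar>x\<bar> + \<bar>y\<bar> = \<bar>x - y\<bar>" by linarith
  then show ?thesis using assms by (auto simp: power2_abs)
qed

lemma power2_abs_add3_le:
  fixes x y z :: real
  assumes "(x + y + z)\<^sup>2 \<le> t" "(x + y - z)\<^sup>2 \<le> t" "(x - y + z)\<^sup>2 \<le> t" "(x - y - z)\<^sup>2 \<le> t"
  shows "(\<bar>x\<bar> + \<bar>y\<bar> + \<bar>z\<bar>)\<^sup>2 \<le> t"
proof -
  have "\<bar>x\<bar> + \<bar>y\<bar> = \<bar>x + y\<bar> \<or> \<bar>x\<bar> + \<bar>y\<bar> = \<bar>x - y\<bar>" by linarith
  then show ?thesis
    using power2_abs_add_le[OF assms(1,2)] power2_abs_add_le[OF assms(3,4)] by auto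
qed

text \<open>Three lines at mutual angles of 60 degrees: every vector is within 30 degrees of one of
  them, and the squared cosine of 30 degrees is 3/4. The spanning vectors have squared length 4,
  hence the factor 3.\<close>

lemma hexagon_cover:
  fixes x y :: real
  shows "3 * (x\<^sup>2 + y\<^sup>2) \<le> (2 * x)\<^sup>2 \<or> 3 * (x\<^sup>2 + y\<^sup>2) \<le> (x + sqrt 3 * y)\<^sup>2 \<or>
    3 * (x\<^sup>2 + y\<^sup>2) \<le> (x - sqrt 3 * y)\<^sup>2"
proof (cases "3 * (x\<^sup>2 + y\<^sup>2) \<le> (2 * x)\<^sup>2")
  case False
  then have "x\<^sup>2 \<le> (sqrt 3 * y)\<^sup>2" by (simp add: power_mult_distrib)
  then have "\<bar>x\<bar> \<le> \<bar>sqrt 3 * y\<bar>" by (simp only: abs_le_square_iff)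
  then have "\<bar>x\<bar> * \<bar>x\<bar> \<le> \<bar>x\<bar> * \<bar>sqrt 3 * y\<bar>" by (intro mult_left_mono) auto
  then have "x * x \<le> \<bar>x * (sqrt 3 * y)\<bar>" by (simp only: abs_mult[symmetric] abs_mult_self_eq)
  then have "x * x \<le> x * (sqrt 3 * y) \<or> x * x \<le> - (x * (sqrt 3 * y))" by linarith
  moreover have "(x + sqrt 3 * y)\<^sup>2 = x * x + 2 * (x * (sqrt 3 * y)) + 3 * y\<^sup>2"
    "(x - sqrt 3 * y)\<^sup>2 = x * x - 2 * (x * (sqrt 3 * y)) + 3 * y\<^sup>2"
    by (simp_all add: power2_sum power2_diff power_mult_distrib flip: power2_eq_square)
  ultimately show ?thesis unfolding power2_eq_square[of x] distrib_left by linarith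
qed simp

text \<open>The lines have angles 0, \<theta>, 2\<theta> and their mirror images, where tan \<theta>
  = 3/4: nearly a regular arrangement, but with rational unit vectors. The widest gap is \<theta>,
  and tan (\<theta>/2) = 1/3 gives the constant 10/9. Here \<open>s\<close> bounds the squared
  lengths of the projections onto the lines.\<close>

lemma plane_cover_5:
  fixes x y s :: real
  assumes "x\<^sup>2 \<le> s" "(4 * x + 3 * y)\<^sup>2 \<le> 25 * s" "(4 * x - 3 * y)\<^sup>2 \<le> 25 * s"
    "(7 * x + 24 * y)\<^sup>2 \<le> 625 * s" "(7 * x - 24 * y)\<^sup>2 \<le> 625 * s"
  shows "x\<^sup>2 + y\<^sup>2 \<le> 10 / 9 * s"
proof -
  define X Y where "X = \<bar>x\<bar>" and "Y = \<bar>y\<bar>"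
  have nn: "X \<ge> 0" "Y \<ge> 0" by (simp_all add: X_def Y_def)
  have 1: "X\<^sup>2 \<le> s" "(4 * X + 3 * Y)\<^sup>2 \<le> 25 * s" "(7 * X + 24 * Y)\<^sup>2 \<le> 625 * s"
    using assms power2_abs_add_le[of "4 * x" "3 * y"] power2_abs_add_le[of "7 * x" "24 * y"]
    by (simp_all add: X_def Y_def abs_mult)
  \<comment> \<open>The cuts are the bisectors at angles \<theta>/2 and 3\<theta>/2, with slopes 1/3
    and 13/9.\<close>
  consider "3 * Y \<le> X" | "X \<le> 3 * Y" "9 * Y \<le> 13 * X" | "13 * X \<le> 9 * Y" by linarith
  then have "X\<^sup>2 + Y\<^sup>2 \<le> 10 / 9 * s"
  proof cases
    case 1
    then have "(3 * Y)\<^sup>2 \<le> X\<^sup>2" using nn by (intro power_mono) auto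
    then show ?thesis using \<open>X\<^sup>2 \<le> s\<close> by (simp add: power_mult_distrib)
  next
    case 2
    then have "0 \<le> (3 * Y - X) * (13 * X - 9 * Y)" by simp
    then show ?thesis using 1(2) by (simp add: power2_eq_square algebra_simps)
  next
    case 3
    then have "0 \<le> (9 * Y - 13 * X) * (3 * Y + 79 * X)" using nn by simp
    then show ?thesis using 1(3) by (simp add: power2_eq_square algebra_simps)
  qed
  then show ?thesis by (simp add: X_def Y_def)
qed

text \<open>In the next lemmas the cone of vectors closest to a given line is cut into simplicial cones. On
  each of them the difference of the two quadratic forms is a combination, with nonnegative
  coefficients, of products of the linear forms that define the cone.\<close>

lemma space_cover_11:
  fixes x y z s :: real
  assumes "x\<^sup>2 \<le> s" "y\<^sup>2 \<le> s" "z\<^sup>2 \<le> s"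
    "(x + z)\<^sup>2 \<le> 2 * s" "(x - z)\<^sup>2 \<le> 2 * s" "(y + z)\<^sup>2 \<le> 2 * s" "(y - z)\<^sup>2 \<le> 2 * s"
    "(2 * x + 2 * y + z)\<^sup>2 \<le> 9 * s" "(2 * x + 2 * y - z)\<^sup>2 \<le> 9 * s"
    "(2 * x - 2 * y + z)\<^sup>2 \<le> 9 * s" "(2 * x - 2 * y - z)\<^sup>2 \<le> 9 * s"
  shows "x\<^sup>2 + y\<^sup>2 + z\<^sup>2 \<le> 11 / 8 * s"
proof -
  \<comment> \<open>The configuration is invariant under changes of sign and under swapping the
    first two coordinates.\<close>
  have main: "X\<^sup>2 + Y\<^sup>2 + Z\<^sup>2 \<le> 11 / 8 * s"
    if nn: "Y \<le> X" "0 \<le> Y" "0 \<le> Z" and le: "X\<^sup>2 \<le> s" "Z\<^sup>2 \<le> s" "(X + Z)\<^sup>2 \<le> 2 * s"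
      "(2 * X + 2 * Y + Z)\<^sup>2 \<le> 9 * s" for X Y Z
  proof -
    \<comment> \<open>The cones belong to (0,0,1), (1,0,0), (2,2,1) and (1,0,1), in this order.
      Exact bisecting planes would involve \<open>sqrt 2\<close>, so rational approximations replace
      them, with 5/12 and 7/17 for \<open>sqrt 2 - 1\<close>. The last three cones meet along the
      ray of (17,5,7).\<close>
    consider "12 * X \<le> 5 * Z" | "17 * Z \<le> 7 * X" "2 * Y + Z \<le> X"
      | "X \<le> 2 * Y + Z" "X + 9 * Z \<le> 16 * Y"
      | "5 * Z \<le> 12 * X" "7 * X \<le> 17 * Z" "16 * Y \<le> X + 9 * Z"
      by linarith
    then show ?thesis
    proof cases
      case 1
      have "(12 * X)\<^sup>2 \<le> (5 * Z)\<^sup>2" "Y\<^sup>2 \<le> X\<^sup>2" using 1 nn by (intro power_mono; linarith)+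
      then have "144 * X\<^sup>2 \<le> 25 * Z\<^sup>2" "Y\<^sup>2 \<le> X\<^sup>2" by (simp_all add: power_mult_distrib)
      then show ?thesis using le(2) zero_le_power2[of Z] by linarith
    next
      case 2
      \<comment> \<open>The factor 289 makes the coefficients integral;
        \<open>nonneg_if_multiple_nonneg\<close> removes it again.\<close>
      have "289 * (3 * X\<^sup>2 - 8 * (Y\<^sup>2 + Z\<^sup>2)) = 1156 * (Y * (X - 2 * Y - Z)) + 578 * (X * (X - 2 * Y - Z))
        + 136 * (Z * (7 * X - 17 * Z)) + 22 * (X * (7 * X - 17 * Z)) + 1156 * (Y * Z) + 135 * X\<^sup>2"
        by (simp add: power2_eq_square algebra_simps)
      moreover have "\<dots> \<ge> 0" using 2 nn by simp
      ultimately have "0 \<le> 3 * X\<^sup>2 - 8 * (Y\<^sup>2 + Z\<^sup>2)" by (rule nonneg_if_multiple_nonneg) simp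
      then show ?thesis using le(1) unfolding distrib_left by linarith
    next
      case 3
      have "11 * (2 * X + 2 * Y + Z)\<^sup>2 - 72 * (X\<^sup>2 + Y\<^sup>2 + Z\<^sup>2) \<ge> 0"
      \<comment> \<open>This cone has the four edges (1,1,0), (2,1,0), (17,5,7) and (3,3,5); the
        plane through the first and the third leaves two simplicial cones.\<close>
      proof (cases "7 * (X - Y) \<le> 12 * Z")
        case True
        define a b c where abc: "a = 12 * Z - 7 * (X - Y)" "b = 16 * Y - X - 9 * Z" "c = X - Y"
        have nonneg: "0 \<le> a" "0 \<le> b" "0 \<le> c" using True 3 nn unfolding abc by linarith+
        have "3600 * (11 * (2 * X + 2 * Y + Z)\<^sup>2 - 72 * (X\<^sup>2 + Y\<^sup>2 + Z\<^sup>2)) =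
          83 * a\<^sup>2 + 512 * b\<^sup>2 + 61875 * c\<^sup>2 + 2528 * (a * b) + 22650 * (a * c) + 26400 * (b * c)"
          unfolding abc by (simp add: power2_eq_square algebra_simps)
        moreover have "\<dots> \<ge> 0" using nonneg by simp
        ultimately show ?thesis by (rule nonneg_if_multiple_nonneg) simp
      next
        case False
        define a b where ab: "a = 7 * (X - Y) - 12 * Z" "b = 2 * Y + Z - X"
        have nonneg: "0 \<le> a" "0 \<le> b" using False 3 nn unfolding ab by linarith+
        have "49 * (11 * (2 * X + 2 * Y + Z)\<^sup>2 - 72 * (X\<^sup>2 + Y\<^sup>2 + Z\<^sup>2)) =
          36 * a\<^sup>2 + 1568 * b\<^sup>2 + 2475 * Z\<^sup>2 + 672 * (a * b) + 1116 * (a * Z) + 9240 * (b * Z)"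
          unfolding ab by (simp add: power2_eq_square algebra_simps)
        moreover have "\<dots> \<ge> 0" using nonneg nn by simp
        ultimately show ?thesis by (rule nonneg_if_multiple_nonneg) simp
      qed
      then show ?thesis using le(4) unfolding distrib_left by linarith
    next
      case 4
      have "11 * (X + Z)\<^sup>2 \<ge> 16 * (X\<^sup>2 + Y\<^sup>2 + Z\<^sup>2)"
      \<comment> \<open>At \<open>5 * X = 3 * Z\<close> the two upper bounds for \<open>Y\<close>,
        namely \<open>X\<close> and \<open>(X + 9 * Z) / 16\<close>, cross; each case uses the
        smaller one.\<close>
      proof (cases "5 * X \<le> 3 * Z")
        case True
        define a b where ab: "a = 3 * Z - 5 * X" "b = 12 * X - 5 * Z"
        have nonneg: "0 \<le> a" "0 \<le> b" using True 4 unfolding ab by linarith+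
        have "121 * (11 * (X + Z)\<^sup>2 - 16 * (2 * X\<^sup>2 + Z\<^sup>2)) = 75 * a\<^sup>2 + 112 * (a * b) + 16 * b\<^sup>2"
          unfolding ab by (simp add: power2_eq_square algebra_simps)
        moreover have "\<dots> \<ge> 0" using nonneg by simp
        ultimately have "0 \<le> 11 * (X + Z)\<^sup>2 - 16 * (2 * X\<^sup>2 + Z\<^sup>2)"
          by (rule nonneg_if_multiple_nonneg) simp
        moreover have "Y\<^sup>2 \<le> X\<^sup>2" using nn by (intro power_mono)
        ultimately show ?thesis unfolding distrib_left by linarith
      next
        case False
        define a b where ab: "a = 5 * X - 3 * Z" "b = 17 * Z - 7 * X"
        have nonneg: "0 \<le> a" "0 \<le> b" using False 4 unfolding ab by linarith+
        have "2816 * (X + Z)\<^sup>2 - 4096 * (X\<^sup>2 + Z\<^sup>2) - 16 * (X + 9 * Z)\<^sup>2 = 33 * a\<^sup>2 + 62 * (a * b) + b\<^sup>2"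
          unfolding ab by (simp add: power2_eq_square algebra_simps)
        moreover have "\<dots> \<ge> 0" using nonneg by simp
        moreover have "(16 * Y)\<^sup>2 \<le> (X + 9 * Z)\<^sup>2" using 4 nn by (intro power_mono) auto
        then have "256 * Y\<^sup>2 \<le> (X + 9 * Z)\<^sup>2" by (simp add: power_mult_distrib)
        ultimately show ?thesis unfolding distrib_left by linarith
      qed
      then show ?thesis using le(3) unfolding distrib_left by linarith
    qed
  qed
  define X Y Z where "X = \<bar>x\<bar>" and "Y = \<bar>y\<bar>" and "Z = \<bar>z\<bar>"
  have "(X + Z)\<^sup>2 \<le> 2 * s" "(Y + Z)\<^sup>2 \<le> 2 * s"
    using assms by (simp_all add: X_def Y_def Z_def power2_abs_add_le)
  moreover have "(2 * X + 2 * Y + Z)\<^sup>2 \<le> 9 * s"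
    using assms power2_abs_add3_le[of "2 * x" "2 * y" z "9 * s"]
    by (simp add: X_def Y_def Z_def abs_mult)
  moreover have "X\<^sup>2 \<le> s" "Y\<^sup>2 \<le> s" "Z\<^sup>2 \<le> s" "0 \<le> X" "0 \<le> Y" "0 \<le> Z"
    using assms(1-3) by (simp_all add: X_def Y_def Z_def)
  ultimately have "X\<^sup>2 + Y\<^sup>2 + Z\<^sup>2 \<le> 11 / 8 * s"
    using main[of Y X Z] main[of X Y Z] by (cases "Y \<le> X") (simp_all add: add_ac)
  then show ?thesis by (simp add: X_def Y_def Z_def)
qed

text \<open>Two orthogonal copies of this configuration suffice in dimension 6 when the constant below is
  less than \<open>6/5\<close>, which allows only a narrow range of ratios around \<open>9 : 4\<close>.\<close>

lemma space_cover_16_sorted: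
  fixes x y z s :: real
  assumes sorted: "z \<le> y" "y \<le> x" "0 \<le> z"
    and le: "(x + y + z)\<^sup>2 \<le> 3 * s" "(9 * x + 4 * y)\<^sup>2 \<le> 97 * s"
  shows "x\<^sup>2 + y\<^sup>2 + z\<^sup>2 \<le> 599 / 500 * s"
\<comment> \<open>A rational approximation of the plane at equal angles from (9,4,0) and (1,1,1);
  the first vector serves the side where the inequality holds.\<close>
proof (cases "23 * y + 77 * z \<le> 45 * x")
  case True
  have "599 * (9 * x + 4 * y)\<^sup>2 - 48500 * (x\<^sup>2 + y\<^sup>2 + z\<^sup>2) \<ge> 0"
  \<comment> \<open>The edges are (1,0,0), (1,1,0), (7,7,2) and (20,9,9); the cut passes through the
    first and the third. The cone on the other side of the outer cut is already simplicial.\<close>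
  proof (cases "7 * z \<le> 2 * y")
    case True
    define a b where ab: "a = 2 * y - 7 * z" "b = x - y"
    have nonneg: "0 \<le> a" "0 \<le> b" using True sorted unfolding ab by linarith+
    have "4 * (599 * (9 * x + 4 * y)\<^sup>2 - 48500 * (x\<^sup>2 + y\<^sup>2 + z\<^sup>2)) =
      4231 * a\<^sup>2 + 76 * b\<^sup>2 + 13319 * z\<^sup>2 + 86332 * (a * b) + 59234 * (a * z) + 604324 * (b * z)"
      unfolding ab by (simp add: power2_eq_square algebra_simps)
    moreover have "\<dots> \<ge> 0" using nonneg sorted by simp
    ultimately show ?thesis by (rule nonneg_if_multiple_nonneg) simp
  next
    case False
    define a b c where abc: "a = 45 * x - 23 * y - 77 * z" "b = 7 * z - 2 * y" "c = y - z"
    have nonneg: "0 \<le> a" "0 \<le> b" "0 \<le> c"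
      using False \<open>23 * y + 77 * z \<le> 45 * x\<close> sorted unfolding abc by linarith+
    have "2025 * (599 * (9 * x + 4 * y)\<^sup>2 - 48500 * (x\<^sup>2 + y\<^sup>2 + z\<^sup>2)) =
      19 * a\<^sup>2 + 689944 * b\<^sup>2 + 1078839 * c\<^sup>2 + 388912 * (a * b) + 2719458 * (a * c)
      + 18997992 * (b * c)"
      unfolding abc by (simp add: power2_eq_square algebra_simps)
    moreover have "\<dots> \<ge> 0" using nonneg by simp
    ultimately show ?thesis by (rule nonneg_if_multiple_nonneg) simp
  qed
  then show ?thesis using le(2) unfolding distrib_left by linarith
next
  case False
  define a b c where abc: "a = 23 * y + 77 * z - 45 * x" "b = x - y" "c = y - z"
  have nonneg: "0 \<le> a" "0 \<le> b" "0 \<le> c" using False sorted unfolding abc by linarith+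
  have "275 * (599 * (x + y + z)\<^sup>2 - 1500 * (x\<^sup>2 + y\<^sup>2 + z\<^sup>2)) =
    81 * a\<^sup>2 + 49900 * b\<^sup>2 + 3784 * c\<^sup>2 + 10260 * (a * b) + 9504 * (a * c) + 326920 * (b * c)"
    unfolding abc by (simp add: power2_eq_square algebra_simps)
  moreover have "\<dots> \<ge> 0" using nonneg by simp
  ultimately have "0 \<le> 599 * (x + y + z)\<^sup>2 - 1500 * (x\<^sup>2 + y\<^sup>2 + z\<^sup>2)"
    by (rule nonneg_if_multiple_nonneg) simp
  then show ?thesis using le(1) unfolding distrib_left by linarith
qed

text \<open>The lines are the four diagonals of a cube and the twelve images of the line of (9,4,0)
  under signed permutations. The whole set is invariant under these, so sorting the absolute values
  of the coordinates suffices.\<close>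

lemma space_cover_16:
  fixes x y z s :: real
  assumes "(x + y + z)\<^sup>2 \<le> 3 * s" "(x + y - z)\<^sup>2 \<le> 3 * s" "(x - y + z)\<^sup>2 \<le> 3 * s"
    "(x - y - z)\<^sup>2 \<le> 3 * s"
    "(9 * x + 4 * y)\<^sup>2 \<le> 97 * s" "(9 * x - 4 * y)\<^sup>2 \<le> 97 * s"
    "(9 * x + 4 * z)\<^sup>2 \<le> 97 * s" "(9 * x - 4 * z)\<^sup>2 \<le> 97 * s"
    "(4 * x + 9 * y)\<^sup>2 \<le> 97 * s" "(4 * x - 9 * y)\<^sup>2 \<le> 97 * s"
    "(9 * y + 4 * z)\<^sup>2 \<le> 97 * s" "(9 * y - 4 * z)\<^sup>2 \<le> 97 * s"
    "(4 * x + 9 * z)\<^sup>2 \<le> 97 * s" "(4 * x - 9 * z)\<^sup>2 \<le> 97 * s"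
    "(4 * y + 9 * z)\<^sup>2 \<le> 97 * s" "(4 * y - 9 * z)\<^sup>2 \<le> 97 * s"
  shows "x\<^sup>2 + y\<^sup>2 + z\<^sup>2 \<le> 599 / 500 * s"
proof -
  define X Y Z where "X = \<bar>x\<bar>" and "Y = \<bar>y\<bar>" and "Z = \<bar>z\<bar>"
  have nn: "0 \<le> X" "0 \<le> Y" "0 \<le> Z" by (simp_all add: X_def Y_def Z_def)
  have sum: "(X + Y + Z)\<^sup>2 \<le> 3 * s"
    using assms(1-4) by (simp add: X_def Y_def Z_def power2_abs_add3_le)
  have pair: "(9 * \<bar>a\<bar> + 4 * \<bar>b\<bar>)\<^sup>2 \<le> 97 * s"
    if "(9 * a + 4 * b)\<^sup>2 \<le> 97 * s" "(9 * a - 4 * b)\<^sup>2 \<le> 97 * s" for a b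
    using power2_abs_add_le[OF that] by (simp add: abs_mult)
  have pair': "(9 * \<bar>b\<bar> + 4 * \<bar>a\<bar>)\<^sup>2 \<le> 97 * s"
    if "(4 * a + 9 * b)\<^sup>2 \<le> 97 * s" "(4 * a - 9 * b)\<^sup>2 \<le> 97 * s" for a b
    using power2_abs_add_le[OF that] by (simp add: abs_mult add.commute)
  have pairs: "(9 * X + 4 * Y)\<^sup>2 \<le> 97 * s" "(9 * X + 4 * Z)\<^sup>2 \<le> 97 * s"
    "(9 * Y + 4 * X)\<^sup>2 \<le> 97 * s" "(9 * Y + 4 * Z)\<^sup>2 \<le> 97 * s"
    "(9 * Z + 4 * X)\<^sup>2 \<le> 97 * s" "(9 * Z + 4 * Y)\<^sup>2 \<le> 97 * s"
    unfolding X_def Y_def Z_def using assms(5-) pair pair' by blast+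
  have main: "a\<^sup>2 + b\<^sup>2 + c\<^sup>2 \<le> 599 / 500 * s"
    if "c \<le> b" "b \<le> a" "0 \<le> c" "(9 * a + 4 * b)\<^sup>2 \<le> 97 * s" "a + b + c = X + Y + Z" for a b c
    using space_cover_16_sorted[OF that(1-3) _ that(4)] sum unfolding that(5) .
  consider "Z \<le> Y" "Y \<le> X" | "Y \<le> Z" "Z \<le> X" | "Z \<le> X" "X \<le> Y" | "X \<le> Z" "Z \<le> Y"
    | "Y \<le> X" "X \<le> Z" | "X \<le> Y" "Y \<le> Z"
    by linarith
  then have "X\<^sup>2 + Y\<^sup>2 + Z\<^sup>2 \<le> 599 / 500 * s"
  proof cases
    case 1
    then show ?thesis using main[OF _ _ nn(3) pairs(1)] by linarith
  next
    case 2
    then show ?thesis using main[OF _ _ nn(2) pairs(2)] by linarith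
  next
    case 3
    then show ?thesis using main[OF _ _ nn(3) pairs(3)] by linarith
  next
    case 4
    then show ?thesis using main[OF _ _ nn(1) pairs(4)] by linarith
  next
    case 5
    then show ?thesis using main[OF _ _ nn(2) pairs(5)] by linarith
  next
    case 6
    then show ?thesis using main[OF _ _ nn(1) pairs(6)] by linarith
  qed
  then show ?thesis by (simp add: X_def Y_def Z_def)
qed

section \<open>The configurations in dimensions 4, 5 and 6\<close>

lemma xray_number_le_dim4:
  fixes W :: "'a::euclidean_space set"
  assumes W: "convex_body W" "constant_width W" and d: "DIM('a) = 4"
  shows "xray_number W \<le> 6"
proof -
  obtain bs :: "'a list" where bs: "distinct bs" "set bs = Basis" "length bs = 4"
    "\<And>c. \<exists>xs. length xs = 4 \<and> c = lincomb bs xs"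
    using obtain_basis_list d by metis
  have inn: "lincomb bs ks \<bullet> lincomb bs ls = ks!0 * ls!0 + ks!1 * ls!1 + ks!2 * ls!2 + ks!3 * ls!3"
    for ks ls
    using inner_lincomb[OF bs(1) equalityD1[OF bs(2)], of ks ls]
    by (simp add: bs(3) eval_nat_numeral)
  let ?q = "sqrt 3"
  define P where "P = lincomb bs ` {[2, 0, 0, 0], [1, ?q, 0, 0], [1, - ?q, 0, 0]}"
  define Q where "Q = lincomb bs ` {[0, 0, 2, 0], [0, 0, 1, ?q], [0, 0, 1, - ?q]}"
  have v4: "v \<bullet> v = 4" if "v \<in> P \<union> Q" for v
    using that by (auto simp: P_def Q_def inn)
  have orth: "v \<bullet> u = 0" if "v \<in> P" "u \<in> Q" for u v
    using that by (auto simp: P_def Q_def inn)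
  \<comment> \<open>Two hexagonal configurations in orthogonal planes do not give the strict
    inequality of \<open>xray_number_le_cover\<close>, so the normals themselves must be
    examined.\<close>
  have "xray_number W \<le> enat (card (P \<union> Q))"
  proof (rule xray_number_le_card[OF W])
    show "finite (P \<union> Q)" by (simp add: P_def Q_def)
    show "0 \<notin> P \<union> Q" using v4[of 0] by auto
    fix n assume n: "\<And>v. v \<in> P \<union> Q \<Longrightarrow> norm (n v) = 1" "\<And>v. v \<in> P \<union> Q \<Longrightarrow> n v \<bullet> v = 0"
      "\<And>u v. u \<in> P \<union> Q \<Longrightarrow> v \<in> P \<union> Q \<Longrightarrow> n u \<bullet> n v \<ge> 1/2"
    let ?k = "sqrt (5 / 8)"
    have ne: "n ` (P \<union> Q) \<noteq> {}" "finite (n ` (P \<union> Q))" by (simp_all add: P_def Q_def)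
    obtain c where c: "norm c = 1" "\<And>m. m \<in> n ` (P \<union> Q) \<Longrightarrow> ?k \<le> m \<bullet> c"
      using n by (rule_tac spherical_jung[OF ne(2,1)]) (auto simp: d)
    \<comment> \<open>The bound is \<open>4 * (1 - 5 / 8)\<close>.\<close>
    have upper: "(v \<bullet> c)\<^sup>2 \<le> 3 / 2" if "v \<in> P \<union> Q" for v
      using inner_le_of_orthogonal[of "n v" c v ?k] n c that v4[OF that] by simp
    have eq: "?k *\<^sub>R n v = c - ((v \<bullet> c) / 4) *\<^sub>R v" if "v \<in> P \<union> Q" "(v \<bullet> c)\<^sup>2 = 3 / 2" for v
      using eq_of_inner_eq_of_orthogonal[of "n v" c v ?k] n c that v4[OF that(1)] by fastforce
    obtain xs where xs: "c = lincomb bs xs" using bs(4) by blast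
    define A B where "A = (xs!0)\<^sup>2 + (xs!1)\<^sup>2" and "B = (xs!2)\<^sup>2 + (xs!3)\<^sup>2"
    have AB: "A + B = 1"
      using c(1) unfolding xs A_def B_def by (simp add: norm_eq_1 inn power2_eq_square)
    have "\<exists>v\<in>P. 3 * A \<le> (v \<bullet> c)\<^sup>2"
      using hexagon_cover[of "xs!0" "xs!1"] unfolding A_def xs P_def by (simp add: inn)
    then obtain v where v: "v \<in> P" "3 * A \<le> (v \<bullet> c)\<^sup>2" by blast
    have "\<exists>u\<in>Q. 3 * B \<le> (u \<bullet> c)\<^sup>2"
      using hexagon_cover[of "xs!2" "xs!3"] unfolding B_def xs Q_def by (simp add: inn)
    then obtain u where u: "u \<in> Q" "3 * B \<le> (u \<bullet> c)\<^sup>2" by blast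
    \<comment> \<open>The two squares add up to at least \<open>3 * (A + B) = 3\<close>, while each
      is at most 3/2; equality is forced.\<close>
    have v2: "(v \<bullet> c)\<^sup>2 = 3 / 2" and u2: "(u \<bullet> c)\<^sup>2 = 3 / 2"
      using upper[of v] upper[of u] v u AB by auto
    \<comment> \<open>In the equality case both normals are known. Since \<open>v\<close> and
      \<open>u\<close> are orthogonal, the product is 1 - 3/8 - 3/8 = 1/4, so the normals have inner
      product 2/5.\<close>
    have "5 / 8 * (n v \<bullet> n u) = (?k * ?k) * (n v \<bullet> n u)"
      by (simp only: real_sqrt_mult_self)
    also have "\<dots> = (?k *\<^sub>R n v) \<bullet> (?k *\<^sub>R n u)"
      by (simp only: inner_scaleR_left inner_scaleR_right mult.assoc)
    also have "\<dots> = c \<bullet> c - (v \<bullet> c)\<^sup>2 / 4 - (u \<bullet> c)\<^sup>2 / 4 + (v \<bullet> c) * (u \<bullet> c) / 16 * (v \<bullet> u)"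
      using eq[OF _ v2] eq[OF _ u2] v(1) u(1)
      by (simp add: inner_diff_left inner_diff_right inner_commute power2_eq_square)
    also have "\<dots> = 1 / 4"
      using orth[OF v(1) u(1)] c(1) by (simp add: v2 u2 norm_eq_1)
    finally show False using n(3)[of v u] v(1) u(1) by simp
  qed
  also have "card (P \<union> Q) \<le> 6"
  proof -
    have "card P \<le> 3" "card Q \<le> 3"
      unfolding P_def Q_def by (rule order_trans[OF card_image_le], simp, simp add: card_insert_if)+
    then show ?thesis using card_Un_le[of P Q] by linarith
  qed
  then have "enat (card (P \<union> Q)) \<le> 6" by (simp add: numeral_eq_enat)
  finally show ?thesis .
qed

lemma xray_number_le_dim5:
  fixes W :: "'a::euclidean_space set"
  assumes W: "convex_body W" "constant_width W" and d: "DIM('a) = 5"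
  shows "xray_number W \<le> 16"
proof -
  \<comment> \<open>The vectors are left unnormalised, with integer entries: the covering inequality
    is homogeneous in each of them.\<close>
  define Ks :: "real list list" where "Ks =
    map (\<lambda>(a, b). [a, b, 0, 0, 0]) [(1, 0), (4, 3), (4, -3), (7, 24), (7, -24)] @
    map (\<lambda>(a, b, c). [0, 0, a, b, c]) [(1, 0, 0), (0, 1, 0), (0, 0, 1), (1, 0, 1), (1, 0, -1),
      (0, 1, 1), (0, 1, -1), (2, 2, 1), (2, 2, -1), (2, -2, 1), (2, -2, -1)]"
  have "xray_number W \<le> enat (length Ks)"
  proof (rule xray_number_le_cover_coordinates[OF W d], rule ccontr)
    fix xs :: "real list"
    assume len: "length xs = 5" and one: "(\<Sum>i<5. (xs ! i)\<^sup>2) = 1"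
      and no: "\<not> (\<exists>ks\<in>set Ks. (\<Sum>i<5. (ks ! i)\<^sup>2) * ((real 5 - 1) / (2 * real 5)) <
        (\<Sum>i<5. ks ! i * xs ! i)\<^sup>2)"
    obtain x1 x2 x3 x4 x5 where xs: "xs = [x1, x2, x3, x4, x5]"
      using len by (auto simp: eval_nat_numeral length_Suc_conv)
    have bd: "(a * x1 + b * x2 + c * x3 + d * x4 + e * x5)\<^sup>2
        \<le> (a\<^sup>2 + b\<^sup>2 + c\<^sup>2 + d\<^sup>2 + e\<^sup>2) * (2 / 5)"
      if "[a, b, c, d, e] \<in> set Ks" for a b c d e
      using bspec[OF no[unfolded bex_simps not_less] that]
      by (simp add: xs eval_nat_numeral)
    have "x1\<^sup>2 + x2\<^sup>2 \<le> 10 / 9 * (2 / 5)"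
      using bd[of 1 0 0 0 0] bd[of 4 3 0 0 0] bd[of 4 "-3" 0 0 0] bd[of 7 24 0 0 0]
        bd[of 7 "-24" 0 0 0]
      by (intro plane_cover_5) (simp_all add: Ks_def)
    moreover have "x3\<^sup>2 + x4\<^sup>2 + x5\<^sup>2 \<le> 11 / 8 * (2 / 5)"
      using bd[of 0 0 1 0 0] bd[of 0 0 0 1 0] bd[of 0 0 0 0 1] bd[of 0 0 1 0 1] bd[of 0 0 1 0 "-1"]
        bd[of 0 0 0 1 1] bd[of 0 0 0 1 "-1"] bd[of 0 0 2 2 1] bd[of 0 0 2 2 "-1"]
        bd[of 0 0 2 "-2" 1] bd[of 0 0 2 "-2" "-1"]
      by (intro space_cover_11) (simp_all add: Ks_def)
    moreover have "x1\<^sup>2 + x2\<^sup>2 + x3\<^sup>2 + x4\<^sup>2 + x5\<^sup>2 = 1"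
      using one by (simp add: xs eval_nat_numeral)
    \<comment> \<open>The two parts of the unit vector contribute at most 4/9 + 11/20 =
      179/180.\<close>
    ultimately show False by linarith
  qed
  also have "length Ks = 16" by (simp add: Ks_def)
  finally show ?thesis by (simp add: numeral_eq_enat)
qed

lemma xray_number_le_dim6:
  fixes W :: "'a::euclidean_space set"
  assumes W: "convex_body W" "constant_width W" and d: "DIM('a) = 6"
  shows "xray_number W \<le> 32"
proof -
  define Vs :: "(real \<times> real \<times> real) list" where "Vs =
    [(1, 1, 1), (1, 1, -1), (1, -1, 1), (1, -1, -1),
     (9, 4, 0), (9, -4, 0), (9, 0, 4), (9, 0, -4), (4, 9, 0), (4, -9, 0),
     (0, 9, 4), (0, 9, -4), (4, 0, 9), (4, 0, -9), (0, 4, 9), (0, 4, -9)]"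
  define Ks :: "real list list" where "Ks =
    map (\<lambda>(a, b, c). [a, b, c, 0, 0, 0]) Vs @ map (\<lambda>(a, b, c). [0, 0, 0, a, b, c]) Vs"
  have "xray_number W \<le> enat (length Ks)"
  proof (rule xray_number_le_cover_coordinates[OF W d], rule ccontr)
    fix xs :: "real list"
    assume len: "length xs = 6" and one: "(\<Sum>i<6. (xs ! i)\<^sup>2) = 1"
      and no: "\<not> (\<exists>ks\<in>set Ks. (\<Sum>i<6. (ks ! i)\<^sup>2) * ((real 6 - 1) / (2 * real 6)) <
        (\<Sum>i<6. ks ! i * xs ! i)\<^sup>2)"
    obtain x1 x2 x3 x4 x5 x6 where xs: "xs = [x1, x2, x3, x4, x5, x6]"
      using len by (auto simp: eval_nat_numeral length_Suc_conv)
    have bd: "(\<Sum>i<6. ks ! i * xs ! i)\<^sup>2 \<le> (\<Sum>i<6. (ks ! i)\<^sup>2) * (5 / 12)" if "ks \<in> set Ks" for ks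
      using bspec[OF no[unfolded bex_simps not_less] that] by simp
    have bd1: "(a * x1 + b * x2 + c * x3)\<^sup>2 \<le> (a\<^sup>2 + b\<^sup>2 + c\<^sup>2) * (5 / 12)"
      if "(a, b, c) \<in> set Vs" for a b c
    proof -
      have "[a, b, c, 0, 0, 0] \<in> set Ks" using that unfolding Ks_def by force
      from bd[OF this] show ?thesis by (simp add: xs eval_nat_numeral)
    qed
    have bd2: "(a * x4 + b * x5 + c * x6)\<^sup>2 \<le> (a\<^sup>2 + b\<^sup>2 + c\<^sup>2) * (5 / 12)"
      if "(a, b, c) \<in> set Vs" for a b c
    proof -
      have "[0, 0, 0, a, b, c] \<in> set Ks" using that unfolding Ks_def by force
      from bd[OF this] show ?thesis by (simp add: xs eval_nat_numeral)
    qed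
    have sum3: "x\<^sup>2 + y\<^sup>2 + z\<^sup>2 \<le> 599 / 500 * (5 / 12)"
      if "\<And>a b c. (a, b, c) \<in> set Vs \<Longrightarrow> (a * x + b * y + c * z)\<^sup>2 \<le> (a\<^sup>2 + b\<^sup>2 + c\<^sup>2) * (5 / 12)"
      for x y z
      using that[of 1 1 1] that[of 1 1 "-1"] that[of 1 "-1" 1] that[of 1 "-1" "-1"]
        that[of 9 4 0] that[of 9 "-4" 0] that[of 9 0 4] that[of 9 0 "-4"] that[of 4 9 0]
        that[of 4 "-9" 0] that[of 0 9 4] that[of 0 9 "-4"] that[of 4 0 9] that[of 4 0 "-9"]
        that[of 0 4 9] that[of 0 4 "-9"]
      by (intro space_cover_16) (simp_all add: Vs_def)
    have "x1\<^sup>2 + x2\<^sup>2 + x3\<^sup>2 + x4\<^sup>2 + x5\<^sup>2 + x6\<^sup>2 = 1"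
      using one by (simp add: xs eval_nat_numeral)
    \<comment> \<open>Each half contributes at most 599/1200, which leaves the sum just below
      1.\<close>
    then show False using sum3[OF bd1] sum3[OF bd2] by linarith
  qed
  also have "length Ks = 32" by (simp add: Ks_def Vs_def)
  finally show ?thesis by (simp add: numeral_eq_enat)
qed

theorem theorem3p2:
  fixes W :: "'a::euclidean_space set"
  assumes "convex_body W" and "constant_width W"
  shows "(DIM('a) = 4 \<longrightarrow> xray_number W \<le> 6) \<and>
         (DIM('a) \<in> {5, 6} \<longrightarrow> xray_number W \<le> 2 ^ (DIM('a) - 1))"
  using xray_number_le_dim4[OF assms] xray_number_le_dim5[OF assms] xray_number_le_dim6[OF assms]
  by auto

end
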